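(* Let $(V,V^+)$ be an ordered real vector space such that $V^+$ is a full cone for $V$. If $E$ is a subspace of $V$ that majorizes $V^+$, and if $f : E \to \mathbb{R}$ is a positive $\mathbb{R}$-linear functional on $E$, then there exists a positive $\mathbb{R}$-linear functional $\widetilde{f} : V \to \mathbb{R}$ such that $\widetilde{f}|_E = f$.
   Context: A cone in a real vector space $V$ is a nonempty subset $C\subseteq V$ with $av\in C$ for all $a\in[0,\infty)$, $v\in C$, and $v+w\in C$ for all $v,w\in C$. An ordered real vector space $(V,V^+)$ is a real vector space $V$ together with a cone $V^+\subseteq V$ such that $V^+\cap -V^+=\{0\}$. One writes $v\ge w$ (or $w\le v$) if $v-w\in V^+$. The cone $V^+$ is full if $V=V^+-V^+$. A subset $S\subseteq V$ majorizes $V^+$ if for each $v\in V^+$ there exists $w\in S$ with $w\ge v$. An $\mathbb{R}$-linear functional $f$ on $V$ (respectively on a subspace $E$ of $V$) is positive if $f(v)\ge 0$ for all $v\in V^+$ (respectively for all $v\in E\cap V^+$). *)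

theory Defs
  imports "HOL-Analysis.Convex"
begin

text \<open>Cones here are nonempty and closed under addition, so they are the library's
  \<^const>\<open>convex_cone\<close>; the library's \<^const>\<open>cone\<close> requires neither.\<close>

lemma convex_cone_nonempty_scale_add:
  "convex_cone C \<longleftrightarrow>
     C \<noteq> {} \<and> (\<forall>a\<ge>0. \<forall>v\<in>C. a *\<^sub>R v \<in> C) \<and> (\<forall>v\<in>C. \<forall>w\<in>C. v + w \<in> C)"
proof -
  have "0 \<in> C" if "C \<noteq> {}" "\<forall>a\<ge>0. \<forall>v\<in>C. a *\<^sub>R v \<in> C"
    using that by (metis all_not_in_conv order_refl scaleR_zero_left)
  then show ?thesis
    unfolding convex_cone_iff by blast
qed

text \<open>The vector space is a whole type of class \<open>real_vector\<close>, ordered by the cone \<open>P\<close>;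
  no order type class is involved.\<close>

definition ordered_vs :: "'a::real_vector set \<Rightarrow> bool" where
  "ordered_vs P \<longleftrightarrow> convex_cone P \<and> P \<inter> uminus ` P = {0}"

definition cone_le :: "'a::real_vector set \<Rightarrow> 'a \<Rightarrow> 'a \<Rightarrow> bool" where
  "cone_le P w v \<longleftrightarrow> v - w \<in> P"

definition full_cone :: "'a::real_vector set \<Rightarrow> bool" where
  "full_cone P \<longleftrightarrow> (UNIV :: 'a set) = {v - w | v w. v \<in> P \<and> w \<in> P}"

definition majorizes :: "'a::real_vector set \<Rightarrow> 'a set \<Rightarrow> bool" where
  "majorizes S P \<longleftrightarrow> (\<forall>v\<in>P. \<exists>w\<in>S. cone_le P v w)"

text \<open>A functional on a subspace \<open>E\<close> is a total function of which only the values on \<open>E\<close>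
  matter.\<close>

definition linear_functional_on :: "'a::real_vector set \<Rightarrow> ('a \<Rightarrow> real) \<Rightarrow> bool" where
  "linear_functional_on E f \<longleftrightarrow>
     (\<forall>v\<in>E. \<forall>w\<in>E. f (v + w) = f v + f w) \<and> (\<forall>a. \<forall>v\<in>E. f (a *\<^sub>R v) = a * f v)"

lemma linear_functional_on_UNIV: "linear_functional_on UNIV f \<longleftrightarrow> linear f"
  by (auto simp: linear_functional_on_def linear_iff)

definition positive_on :: "'a::real_vector set \<Rightarrow> 'a set \<Rightarrow> ('a \<Rightarrow> real) \<Rightarrow> bool" where
  "positive_on P E f \<longleftrightarrow> (\<forall>v \<in> E \<inter> P. f v \<ge> 0)"

end

theory Submission
  imports Defs "HOL-Analysis.Product_Vector"
begin

text \<open>The proof is that of the M. Riesz extension theorem. A positive functional on a subspace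
  of \<open>V\<close> is regarded as its graph, a linear subspace of \<open>V \<times> \<real>\<close>, so that extension becomes
  inclusion and the union of a chain of extensions is again one.

  The graph \<open>G\<close> of a positive functional whose domain majorizes the cone can be extended to any
  further vector \<open>v\<close> (\<open>positive_graph_extend\<close>). The value \<open>c\<close> at \<open>v\<close> has to satisfy \<open>- r \<le> c\<close>
  whenever \<open>(x, r) \<in> G\<close> and \<open>x + v \<in> P\<close>, and \<open>c \<le> s\<close> whenever \<open>(y, s) \<in> G\<close> and \<open>y - v \<in> P\<close>.
  These bounds are compatible because then \<open>x + y \<in> P\<close>, hence \<open>0 \<le> r + s\<close>. Writing \<open>v\<close> as a
  difference of two elements of the cone and majorizing these shows that both kinds of bounds
  occur, so the supremum of the lower bounds is a suitable \<open>c\<close>. By Zorn's lemma there is a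
  maximal extension, and by the one-step extension its domain is the whole space.\<close>

text \<open>A positive linear subspace of \<open>V \<times> \<real>\<close>. Single-valuedness is not part of the definition:
  it follows from positivity at \<open>0 \<in> P\<close>, see \<open>positive_graph_unique\<close>.\<close>

definition positive_graph :: "'a::real_vector set \<Rightarrow> ('a \<times> real) set \<Rightarrow> bool" where
  "positive_graph P G \<longleftrightarrow> subspace G \<and> (\<forall>(x, r)\<in>G. x \<in> P \<longrightarrow> 0 \<le> r)"

lemma positive_graph_unique:
  assumes G: "positive_graph P G" and "0 \<in> P" and "(x, r) \<in> G" "(x, s) \<in> G"
  shows "r = s"
proof -
  have "(x, r) - (x, s) \<in> G" "(x, s) - (x, r) \<in> G"
    using assms unfolding positive_graph_def by (blast intro: subspace_diff)+
  then have "0 \<le> r - s" "0 \<le> s - r"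
    using G \<open>0 \<in> P\<close> unfolding positive_graph_def by auto
  then show ?thesis by simp
qed

lemma subspace_Union_chain:
  assumes "\<C> \<noteq> {}" and "subset.chain \<A> \<C>" and "\<And>S. S \<in> \<C> \<Longrightarrow> subspace S"
  shows "subspace (\<Union>\<C>)"
proof (rule subspaceI)
  show "0 \<in> \<Union>\<C>"
    using assms(1,3) subspace_0 by blast
  show "x + y \<in> \<Union>\<C>" if xy: "x \<in> \<Union>\<C>" "y \<in> \<Union>\<C>" for x y
  proof -
    obtain S T where ST: "S \<in> \<C>" "x \<in> S" "T \<in> \<C>" "y \<in> T"
      using xy by blast
    with assms(2) have "S \<subseteq> T \<or> T \<subseteq> S"
      unfolding subset_chain_def by blast
    with ST assms(3) show ?thesis
      by (meson UnionI subsetD subspace_add)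
  qed
  show "c *\<^sub>R x \<in> \<Union>\<C>" if "x \<in> \<Union>\<C>" for c x
    using that assms(3) subspace_scale by blast
qed

text \<open>If \<open>v = p - q\<close> with \<open>p, q \<in> P\<close>, any \<open>w\<close> in \<open>S\<close> above \<open>q\<close> works. Applied to \<open>v\<close> and to
  \<open>- v\<close>, this supplies a lower and an upper bound for the value at \<open>v\<close>.\<close>

lemma full_cone_majorizes_translate:
  assumes "convex_cone P" "full_cone P" "majorizes S P"
  obtains w where "w \<in> S" "w + v \<in> P"
proof -
  have "v \<in> {p - q | p q. p \<in> P \<and> q \<in> P}"
    using assms(2) unfolding full_cone_def by blast
  then obtain p q where pq: "v = p - q" "p \<in> P" "q \<in> P"
    by blast
  then obtain w where w: "w \<in> S" "w - q \<in> P"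
    using assms(3) unfolding majorizes_def cone_le_def by blast
  have "(w - q) + p \<in> P"
    using assms(1) w pq by (simp add: convex_cone_nonempty_scale_add)
  then show thesis
    using that[OF w(1)] pq(1) by (simp add: algebra_simps)
qed

lemma positive_graph_extend:
  assumes P: "convex_cone P" "full_cone P"
    and G: "positive_graph P G" and maj: "majorizes (fst ` G) P"
  obtains c where "positive_graph P (span (insert (v, c) G))"
proof -
  have sub: "subspace G" and pos: "\<And>x r. (x, r) \<in> G \<Longrightarrow> x \<in> P \<Longrightarrow> 0 \<le> r"
    using G unfolding positive_graph_def by auto
  have scale: "\<And>a x. 0 \<le> a \<Longrightarrow> x \<in> P \<Longrightarrow> a *\<^sub>R x \<in> P" and add: "\<And>x y. x \<in> P \<Longrightarrow> y \<in> P \<Longrightarrow> x + y \<in> P"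
    using P(1) by (auto simp: convex_cone_nonempty_scale_add)
  define L where "L = {- r | x r. (x, r) \<in> G \<and> x + v \<in> P}"
  have upper: "l \<le> s" if l: "l \<in> L" and s: "(y, s) \<in> G" "y - v \<in> P" for l y s
  proof -
    obtain x r where r: "l = - r" "(x, r) \<in> G" "x + v \<in> P"
      using l unfolding L_def by blast
    have "(x + y, r + s) \<in> G"
      using subspace_add[OF sub r(2) s(1)] by simp
    moreover have "x + y \<in> P"
      using add[OF r(3) s(2)] by simp
    ultimately have "0 \<le> r + s"
      by (rule pos)
    then show ?thesis using r(1) by simp
  qed
  obtain x where "x \<in> fst ` G" "x + v \<in> P"
    by (rule full_cone_majorizes_translate[OF P maj])
  then have "L \<noteq> {}"
    unfolding L_def by auto
  obtain y where "y \<in> fst ` G" "y + - v \<in> P"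
    by (rule full_cone_majorizes_translate[OF P maj])
  then obtain s where ys: "(y, s) \<in> G" "y - v \<in> P"
    by auto
  have "bdd_above L"
    using upper[OF _ ys] by (rule bdd_aboveI)
  define c where "c = Sup L"
  have lower_c: "- r \<le> c" if "(x, r) \<in> G" "x + v \<in> P" for x r
    unfolding c_def by (rule cSup_upper[OF _ \<open>bdd_above L\<close>]) (use that in \<open>auto simp: L_def\<close>)
  have upper_c: "c \<le> s" if "(y, s) \<in> G" "y - v \<in> P" for y s
    unfolding c_def by (rule cSup_least[OF \<open>L \<noteq> {}\<close>]) (rule upper[OF _ that])
  have "0 \<le> q" if q: "(z, q) \<in> span (insert (v, c) G)" and z: "z \<in> P" for z q
  proof -
    obtain k where k: "(z - k *\<^sub>R v, q - k * c) \<in> G"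
      using q sub by (auto simp: span_insert span_eq_iff[THEN iffD2])
    \<comment> \<open>Dividing by \<open>\<bar>k\<bar>\<close> brings the coefficient of \<open>v\<close> to \<open>1\<close> or \<open>- 1\<close>.\<close>
    have quotient: "((1 / \<bar>k\<bar>) *\<^sub>R (z - k *\<^sub>R v), (q - k * c) / \<bar>k\<bar>) \<in> G"
      using subspace_scale[OF sub k, of "1 / \<bar>k\<bar>"] by simp
    have zP: "(1 / \<bar>k\<bar>) *\<^sub>R z \<in> P"
      by (rule scale) (use z in auto)
    consider "k = 0" | "0 < k" | "k < 0" by linarith
    then show ?thesis
    proof cases
      case 1
      then show ?thesis using k z pos by simp
    next
      case 2
      have "- ((q - k * c) / \<bar>k\<bar>) \<le> c"
        by (rule lower_c[OF quotient]) (use 2 zP in \<open>simp add: scaleR_diff_right\<close>)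
      then show ?thesis using 2 by (simp add: field_simps)
    next
      case 3
      have "c \<le> (q - k * c) / \<bar>k\<bar>"
        by (rule upper_c[OF quotient]) (use 3 zP in \<open>simp add: scaleR_diff_right\<close>)
      then show ?thesis using 3 by (simp add: field_simps)
    qed
  qed
  then have "positive_graph P (span (insert (v, c) G))"
    unfolding positive_graph_def by auto
  then show thesis by (rule that)
qed

lemma total_positive_graph_functional:
  assumes G: "positive_graph P G" and "0 \<in> P" and total: "fst ` G = UNIV"
  obtains g where "linear g" "positive_on P UNIV g" "\<And>x r. (x, r) \<in> G \<Longrightarrow> g x = r"
proof -
  have "\<forall>x. \<exists>r. (x, r) \<in> G"
    using total by (metis UNIV_I imageE prod.collapse)
  then obtain g where g: "\<And>x. (x, g x) \<in> G"
    by metis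
  have eq: "g x = r" if "(x, r) \<in> G" for x r
    using positive_graph_unique[OF G \<open>0 \<in> P\<close> g that] .
  have sub: "subspace G"
    using G unfolding positive_graph_def by blast
  have "linear g"
  proof (rule linearI)
    show "g (x + y) = g x + g y" for x y
      using subspace_add[OF sub g g, of x y] by (simp add: eq)
    show "g (a *\<^sub>R x) = a *\<^sub>R g x" for a x
      using subspace_scale[OF sub g, of a x] by (simp add: eq)
  qed
  moreover have "positive_on P UNIV g"
    using G g unfolding positive_on_def positive_graph_def by blast
  ultimately show thesis
    using that eq by blast
qed

theorem theorem2p14:
  fixes P E :: "'a::real_vector set" and f :: "'a \<Rightarrow> real"
  assumes "ordered_vs P"
    and "full_cone P"
    and "subspace E"
    and "majorizes E P"
    and "linear_functional_on E f"
    and "positive_on P E f"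
  shows "\<exists>g :: 'a \<Rightarrow> real. linear g \<and> positive_on P UNIV g \<and> (\<forall>v\<in>E. g v = f v)"
proof -
  have P: "convex_cone P" and "0 \<in> P"
    using assms(1) unfolding ordered_vs_def by auto
  define F where "F = (\<lambda>x. (x, f x)) ` E"
  have "subspace F"
  proof (rule subspaceI)
    have "f (0 *\<^sub>R 0) = 0 * f 0"
      using assms(3,5) subspace_0 unfolding linear_functional_on_def by blast
    then show "0 \<in> F"
      using subspace_0[OF assms(3)] by (auto simp: F_def zero_prod_def image_iff)
    show "x + y \<in> F" if "x \<in> F" "y \<in> F" for x y
      using that assms(5) subspace_add[OF assms(3)]
      by (auto simp: F_def linear_functional_on_def image_iff)
    show "a *\<^sub>R x \<in> F" if "x \<in> F" for a x
      using that assms(5) subspace_scale[OF assms(3)]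
      by (auto simp: F_def linear_functional_on_def image_iff)
  qed
  then have F: "positive_graph P F"
    using assms(6) unfolding positive_graph_def positive_on_def F_def by auto
  define \<A> where "\<A> = {G. positive_graph P G \<and> F \<subseteq> G}"
  have "\<exists>M\<in>\<A>. \<forall>G\<in>\<A>. M \<subseteq> G \<longrightarrow> G = M"
  proof (rule subset_Zorn_nonempty)
    show "\<A> \<noteq> {}"
      using F unfolding \<A>_def by blast
    show "\<Union>\<C> \<in> \<A>" if C: "\<C> \<noteq> {}" "subset.chain \<A> \<C>" for \<C>
    proof -
      have CA: "\<And>G. G \<in> \<C> \<Longrightarrow> positive_graph P G \<and> F \<subseteq> G"
        using C(2) unfolding subset_chain_def \<A>_def by blast
      then have "subspace (\<Union>\<C>)"
        using subspace_Union_chain[OF C] unfolding positive_graph_def by blast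
      then have "positive_graph P (\<Union>\<C>)"
        using CA unfolding positive_graph_def by blast
      then show ?thesis
        using CA C(1) unfolding \<A>_def by blast
    qed
  qed
  then obtain M where "M \<in> \<A>" and M_max: "\<forall>G\<in>\<A>. M \<subseteq> G \<longrightarrow> G = M" ..
  then have M: "positive_graph P M" "F \<subseteq> M"
    unfolding \<A>_def by simp_all
  have "E \<subseteq> fst ` M"
    using M(2) unfolding F_def by force
  then have maj: "majorizes (fst ` M) P"
    using assms(4) unfolding majorizes_def by (meson subsetD)
  have "v \<in> fst ` M" for v
  proof -
    obtain c where c: "positive_graph P (span (insert (v, c) M))"
      using positive_graph_extend[OF P assms(2) M(1) maj] .
    have sup: "insert (v, c) M \<subseteq> span (insert (v, c) M)"
      by (rule span_superset)
    then have "span (insert (v, c) M) \<in> \<A>"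
      using c M(2) unfolding \<A>_def by auto
    then have "span (insert (v, c) M) = M"
      using M_max sup by auto
    then have "(v, c) \<in> M"
      using sup by auto
    then show ?thesis by (rule image_eqI[rotated]) simp
  qed
  then have "fst ` M = UNIV" by auto
  then obtain g where g: "linear g" "positive_on P UNIV g" "\<And>x r. (x, r) \<in> M \<Longrightarrow> g x = r"
    using total_positive_graph_functional[OF M(1) \<open>0 \<in> P\<close>] by metis
  have "\<forall>v\<in>E. g v = f v"
    using g(3) M(2) unfolding F_def by auto
  with g(1,2) show ?thesis by auto
qed

end
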